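(* Let $\Omega\subset\mathbb{C}$ be a connected open set, $T\in\mathcal{B}_1(\Omega)$, $z_0\in\Omega$, and let $B$ be the canonical right inverse of $T-z_0$. Then $T-z_0$ is a backward weighted shift on an orthonormal basis of $\mathcal{H}$ if and only if, for every $k\ge 0$, the subspace $\mathcal{M}_k:=B^k\ker(T-z_0)$ is invariant for $B^*B$.
   Context: $\mathcal{H}$ is a separable, infinite dimensional complex Hilbert space, $\mathcal{L}(\mathcal{H})$ is the algebra of bounded linear operators on $\mathcal{H}$, and $\bigvee$ denotes closed linear span. For a connected open set $\Omega\subset\mathbb{C}$, $\mathcal{B}_1(\Omega)$ is the set of $T\in\mathcal{L}(\mathcal{H})$ such that: $\Omega\subset\sigma(T)$; $\mathrm{ran}(T-z)=\mathcal{H}$ for all $z\in\Omega$; $\bigvee_{z\in\Omega}\ker(T-z)=\mathcal{H}$; and $\dim\ker(T-z)=1$ for all $z\in\Omega$. If $A\in\mathcal{L}(\mathcal{H})$ is surjective, its canonical right inverse is the unique $B\in\mathcal{L}(\mathcal{H})$ with $AB=I$ and $\mathrm{ran}\,B=(\ker A)^\perp$. An operator $A$ is a backward weighted shift on an orthonormal basis $\{e_k\}_{k=0}^\infty$ with weight sequence $\{w_k\}_{k=1}^\infty$ of complex numbers if $Ae_0=0$ and $Ae_k=w_ke_{k-1}$ for $k\ge 1$. *)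

theory Defs
  imports "HOL-Analysis.Analysis"
begin

section \<open>Complex Hilbert spaces\<close>

text \<open>
  A complex inner product space is rendered as a real inner product space (so that norm, metric and
  topology are those of the library) with a complex scalar multiplication extending the real one and a
  Hermitian form, linear in its first argument, whose real part is the given real inner product.
  Then \<open>cinner x x = inner x x\<close>, so positive definiteness and
  \<open>norm x = sqrt (cinner x x)\<close> come from \<^class>\<open>real_inner\<close>.
\<close>

class complex_inner = real_inner +
  fixes scaleC :: "complex \<Rightarrow> 'a \<Rightarrow> 'a" (infixr "*\<^sub>C" 75)
    and cinner :: "'a \<Rightarrow> 'a \<Rightarrow> complex"
  assumes scaleC_add_right: "c *\<^sub>C (x + y) = c *\<^sub>C x + c *\<^sub>C y"
    and scaleC_add_left: "(c + d) *\<^sub>C x = c *\<^sub>C x + d *\<^sub>C x"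
    and scaleC_scaleC: "c *\<^sub>C d *\<^sub>C x = (c * d) *\<^sub>C x"
    and scaleC_of_real: "complex_of_real r *\<^sub>C x = r *\<^sub>R x"
    and cinner_commute: "cinner x y = cnj (cinner y x)"
    and cinner_add_left: "cinner (x + y) z = cinner x z + cinner y z"
    and cinner_scaleC_left: "cinner (c *\<^sub>C x) y = c * cinner x y"
    and Re_cinner: "Re (cinner x y) = inner x y"

class chilbert_space = complex_inner + complete_space

lemma cinner_self: "cinner x x = complex_of_real (inner x x)"
proof (rule complex_eqI)
  show "Re (cinner x x) = Re (complex_of_real (inner x x))"
    by (simp add: Re_cinner)
  have "Im (cinner x x) = - Im (cinner x x)"
    using arg_cong[OF cinner_commute[of x x], of Im] by simp
  then show "Im (cinner x x) = Im (complex_of_real (inner x x))" by simp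
qed

global_interpretation complex_vector: vector_space "scaleC :: complex \<Rightarrow> 'a \<Rightarrow> 'a::complex_inner"
proof
  show "1 *\<^sub>C x = x" for x :: 'a
    using scaleC_of_real[of 1 x] by simp
qed (simp_all add: scaleC_add_right scaleC_add_left scaleC_scaleC)

definition infinite_dimensional :: "'h::complex_inner itself \<Rightarrow> bool" where
  "infinite_dimensional _ \<longleftrightarrow> (\<nexists>S::'h set. finite S \<and> complex_vector.span S = UNIV)"

definition closed_cspan :: "'h::complex_inner set \<Rightarrow> 'h set" where
  "closed_cspan S = closure (complex_vector.span S)"

definition orthogonal_complement :: "'h::complex_inner set \<Rightarrow> 'h set" where
  "orthogonal_complement S = {x. \<forall>y\<in>S. cinner x y = 0}"

definition orthonormal_basis :: "(nat \<Rightarrow> 'h::complex_inner) \<Rightarrow> bool" where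
  "orthonormal_basis e \<longleftrightarrow>
     (\<forall>i j. cinner (e i) (e j) = (if i = j then 1 else 0)) \<and> closed_cspan (range e) = UNIV"

section \<open>Bounded operators\<close>

definition bounded_clinear :: "('h::complex_inner \<Rightarrow> 'h) \<Rightarrow> bool" where
  "bounded_clinear A \<longleftrightarrow> bounded_linear A \<and> (\<forall>c x. A (c *\<^sub>C x) = c *\<^sub>C A x)"

definition kern :: "('h::complex_inner \<Rightarrow> 'h) \<Rightarrow> 'h set" where
  "kern A = {x. A x = 0}"

text \<open>The operator \<open>T - z\<close>.\<close>

definition minus_scalar :: "('h::complex_inner \<Rightarrow> 'h) \<Rightarrow> complex \<Rightarrow> 'h \<Rightarrow> 'h" where
  "minus_scalar T z = (\<lambda>x. T x - z *\<^sub>C x)"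

definition op_spectrum :: "('h::complex_inner \<Rightarrow> 'h) \<Rightarrow> complex set" where
  "op_spectrum T =
     {z. \<nexists>S. bounded_clinear S \<and> S \<circ> minus_scalar T z = id \<and> minus_scalar T z \<circ> S = id}"

text \<open>
  The adjoint of an operator; for a bounded operator on a Hilbert space it exists and is unique.
\<close>

definition cadjoint :: "('h::complex_inner \<Rightarrow> 'h) \<Rightarrow> 'h \<Rightarrow> 'h" where
  "cadjoint A = (THE A'. \<forall>x y. cinner (A x) y = cinner x (A' y))"

definition invariant_for :: "'h set \<Rightarrow> ('h \<Rightarrow> 'h) \<Rightarrow> bool" where
  "invariant_for M A \<longleftrightarrow> A ` M \<subseteq> M"

definition cowen_douglas_1 :: "complex set \<Rightarrow> ('h::complex_inner \<Rightarrow> 'h) set" where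
  "cowen_douglas_1 \<Omega> =
     {T. bounded_clinear T \<and>
         \<Omega> \<subseteq> op_spectrum T \<and>
         (\<forall>z\<in>\<Omega>. range (minus_scalar T z) = UNIV) \<and>
         closed_cspan (\<Union>z\<in>\<Omega>. kern (minus_scalar T z)) = UNIV \<and>
         (\<forall>z\<in>\<Omega>. complex_vector.dim (kern (minus_scalar T z)) = 1)}"

definition canonical_right_inverse :: "('h::complex_inner \<Rightarrow> 'h) \<Rightarrow> ('h \<Rightarrow> 'h) \<Rightarrow> bool" where
  "canonical_right_inverse A B \<longleftrightarrow>
     bounded_clinear B \<and> A \<circ> B = id \<and> range B = orthogonal_complement (kern A)"

lemma canonical_right_inverse_unique:
  assumes "bounded_clinear A" "canonical_right_inverse A B" "canonical_right_inverse A B'"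
  shows "B = B'"
proof
  fix x
  let ?d = "B x - B' x"
  have A: "linear A"
    using assms(1) by (simp add: bounded_clinear_def bounded_linear.linear)
  have "A (B x) = x" "A (B' x) = x"
    using assms(2,3) by (simp_all add: canonical_right_inverse_def fun_eq_iff)
  then have "?d \<in> kern A"
    using A by (simp add: kern_def linear_diff)
  moreover have "B x \<in> orthogonal_complement (kern A)" "B' x \<in> orthogonal_complement (kern A)"
    using assms(2,3) by (auto simp: canonical_right_inverse_def)
  ultimately have "cinner (B x) ?d = 0" "cinner (B' x) ?d = 0"
    by (auto simp: orthogonal_complement_def)
  then have "inner (B x) ?d = 0" "inner (B' x) ?d = 0"
    by (metis Re_cinner zero_complex.sel(1))+
  then have "inner ?d ?d = 0"
    by (simp add: inner_diff_left)
  then show "B x = B' x" by simp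
qed

text \<open>The weights are \<open>w 1, w 2, \<dots>\<close>; the value \<open>w 0\<close> is irrelevant.\<close>

definition backward_weighted_shift ::
    "(nat \<Rightarrow> 'h::complex_inner) \<Rightarrow> (nat \<Rightarrow> complex) \<Rightarrow> ('h \<Rightarrow> 'h) \<Rightarrow> bool" where
  "backward_weighted_shift e w A \<longleftrightarrow>
     A (e 0) = 0 \<and> (\<forall>k\<ge>1. A (e k) = w k *\<^sub>C e (k - 1))"

end

theory Submission
  imports Defs "HOL-Complex_Analysis.Complex_Analysis"
begin

text \<open>
  Write \<open>A = T - z\<^sub>0\<close> and let \<open>u\<close> span \<open>ker A\<close>. If every \<open>M\<^sub>k\<close>, the line spanned by \<open>B\<^sup>k u\<close>,
  is invariant for \<open>B\<^sup>*B\<close>, then \<open>\<langle>B\<^sup>j\<^sup>+\<^sup>1 u, B\<^sup>k\<^sup>+\<^sup>1 u\<rangle>\<close> is a multiple of \<open>\<langle>B\<^sup>j u, B\<^sup>k u\<rangle>\<close>, and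
  \<open>u\<close> is orthogonal to \<open>ran B\<close>; hence the \<open>B\<^sup>k u\<close> are pairwise orthogonal, and \<open>A\<close> shifts the
  normalised sequence backwards. The sequence is total: near \<open>z\<^sub>0\<close> the kernel of \<open>T - z\<close> is spanned
  by \<open>\<Sum>\<^sub>k (z - z\<^sub>0)\<^sup>k B\<^sup>k u\<close>, so a vector orthogonal to all \<open>B\<^sup>k u\<close> is orthogonal to \<open>ker (T - z)\<close> near
  \<open>z\<^sub>0\<close>, and then, by analytic continuation along the connected set \<open>\<Omega>\<close>, for all \<open>z \<in> \<Omega>\<close>.
  Conversely, \<open>B\<close> maps the basis vectors of a backward shift to multiples of their successors,
  so \<open>B\<^sup>*B\<close> is diagonal.
\<close>

section \<open>Complex scalar products, norms and closed spans\<close>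

instance chilbert_space \<subseteq> banach ..

lemma cinner_add_right: "cinner x (y + z) = cinner x y + cinner x z"
  by (metis cinner_add_left cinner_commute complex_cnj_add)

lemma cinner_scaleC_right: "cinner x (c *\<^sub>C y) = cnj c * cinner x y"
  by (metis cinner_commute cinner_scaleC_left complex_cnj_mult)

lemma cinner_zero_left [simp]: "cinner 0 y = 0"
  using cinner_add_left[of 0 0 y] by simp

lemma cinner_diff_right: "cinner x (y - z) = cinner x y - cinner x z"
  using cinner_add_right[of x "y - z" z] by simp

lemma cinner_eq_zero_commute: "cinner x y = 0 \<longleftrightarrow> cinner y x = 0"
  by (metis cinner_commute complex_cnj_zero)

lemma cinner_self_eq_zero [simp]: "cinner x x = 0 \<longleftrightarrow> x = 0"
  by (simp add: cinner_self)

lemma cinner_eqI: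
  assumes "\<And>x. cinner x y = cinner x z"
  shows "y = z"
  using assms[of "y - z"] by (metis cinner_diff_right cinner_self_eq_zero right_minus_eq)

text \<open>Together with \<open>Re_cinner\<close> this reduces complex identities to real inner
  products, where the real Riesz lemma below applies.\<close>

lemma Im_cinner: "Im (cinner x y) = - inner (\<i> *\<^sub>C x) y"
  by (simp add: Re_cinner[symmetric] cinner_scaleC_left)

lemma norm_scaleC: "norm (c *\<^sub>C x) = cmod c * norm x"
proof -
  have "inner (c *\<^sub>C x) (c *\<^sub>C x) = Re (c * cnj c * cinner x x)"
    by (simp add: Re_cinner[symmetric] cinner_scaleC_left cinner_scaleC_right algebra_simps)
  also have "\<dots> = (cmod c)\<^sup>2 * inner x x"
    by (simp add: cinner_self complex_norm_square[symmetric])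
  finally show ?thesis
    by (simp add: norm_eq_sqrt_inner real_sqrt_mult)
qed

lemma norm_cinner_le: "cmod (cinner x y) \<le> norm x * norm y"
proof (cases "cinner x y = 0")
  case False
  \<comment> \<open>The real Cauchy-Schwarz inequality only bounds the real part. The unimodular
    \<open>c\<close> rotates \<open>x\<close> so that the scalar product becomes real and equal to
    its modulus.\<close>
  define c where "c = cnj (sgn (cinner x y))"
  have "of_real (cmod (cinner x y)) = c * cinner x y"
    using False by (simp add: c_def sgn_eq complex_norm_square[symmetric] power2_eq_square
      mult.commute)
  then have "cmod (cinner x y) = inner (c *\<^sub>C x) y"
    by (metis Re_cinner Re_complex_of_real cinner_scaleC_left)
  also have "\<dots> \<le> norm (c *\<^sub>C x) * norm y"
    by (rule norm_cauchy_schwarz)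
  also have "\<dots> = norm x * norm y"
    using False by (simp add: norm_scaleC c_def norm_sgn)
  finally show ?thesis .
qed simp

lemma scaleR_scaleC: "r *\<^sub>R x = complex_of_real r *\<^sub>C x"
  by (simp add: scaleC_of_real)

lemma bounded_linear_cinner_left: "bounded_linear (\<lambda>x. cinner x y)"
proof (rule bounded_linear_intro)
  show "cmod (cinner x y) \<le> norm x * norm y" for x
    by (rule norm_cinner_le)
qed (simp_all add: cinner_add_left scaleR_scaleC cinner_scaleC_left scaleR_conv_of_real)

lemma bounded_linear_scaleC_right: "bounded_linear (\<lambda>x. c *\<^sub>C x)"
proof (rule bounded_linear_intro)
  show "norm (c *\<^sub>C x) \<le> norm x * cmod c" for x
    by (simp add: norm_scaleC)
qed (simp_all add: scaleC_add_right scaleR_scaleC scaleC_scaleC mult.commute)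

lemma subspace_cspan_real: "subspace (complex_vector.span S)"
  by (simp add: subspace_def scaleR_scaleC complex_vector.span_zero complex_vector.span_add
      complex_vector.span_scale)

text \<open>The vectors orthogonal to \<open>x\<close> form a complex subspace, which is closed by
  continuity of the scalar product.\<close>

lemma cinner_closed_cspan_zero:
  assumes "v \<in> closed_cspan S" "\<And>s. s \<in> S \<Longrightarrow> cinner s x = 0"
  shows "cinner v x = 0"
proof -
  have "cinner u x = 0" if "u \<in> complex_vector.span S" for u
    using that
    by (induction rule: complex_vector.span_induct_alt)
      (simp_all add: assms(2) cinner_add_left cinner_scaleC_left)
  then have "complex_vector.span S \<subseteq> {u. cinner u x = 0}"
    by blast
  moreover have "closed {u. cinner u x = 0}"
    by (intro closed_Collect_eq continuous_on_const linear_continuous_on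
        bounded_linear_cinner_left)
  ultimately show ?thesis
    using assms(1) closure_minimal unfolding closed_cspan_def by blast
qed

section \<open>Riesz representation, adjoints and totality\<close>

lemma subspace_closure:
  fixes S :: "'a::real_normed_vector set"
  assumes "subspace S"
  shows "subspace (closure S)"
  unfolding subspace_def
proof (intro conjI ballI allI)
  show "0 \<in> closure S"
    using subspace_0[OF assms] closure_subset by blast
  show "x + y \<in> closure S" if xy: "x \<in> closure S" "y \<in> closure S" for x y
  proof -
    obtain f g where "\<And>n. f n \<in> S" "\<And>n. g n \<in> S" "f \<longlonglongrightarrow> x" "g \<longlonglongrightarrow> y"
      using xy unfolding closure_sequential by blast
    then show ?thesis
      unfolding closure_sequential
      by (intro exI[of _ "\<lambda>n. f n + g n"]) (auto intro: subspace_add[OF assms] tendsto_add)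
  qed
  show "c *\<^sub>R x \<in> closure S" if x: "x \<in> closure S" for c x
  proof -
    obtain f where "\<And>n. f n \<in> S" "f \<longlonglongrightarrow> x"
      using x unfolding closure_sequential by blast
    then show ?thesis
      unfolding closure_sequential
      by (intro exI[of _ "\<lambda>n. c *\<^sub>R f n"])
        (auto intro: subspace_scale[OF assms] tendsto_scaleR)
  qed
qed

text \<open>The representing vector minimises \<open>inner x x - 2 * f x\<close> over
  \<open>S\<close>: if \<open>f\<close> is the product with some \<open>y\<close> in
  \<open>S\<close>, then on \<open>S\<close> this functional is the squared distance to
  \<open>y\<close> up to a constant. With \<open>S = UNIV\<close> the lemma yields adjoints, with
  closed spans orthogonal projections.\<close>

lemma riesz_on_closed_subspace:
  fixes f :: "'a::{real_inner,banach} \<Rightarrow> real"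
  assumes "closed S" "subspace S" "bounded_linear f"
  obtains y where "y \<in> S" "\<And>x. x \<in> S \<Longrightarrow> f x = inner x y"
proof -
  interpret f: bounded_linear f by fact
  define q where "q x = inner x x - 2 * f x" for x
  obtain K where K: "\<And>x. \<bar>f x\<bar> \<le> norm x * K"
    using f.bounded by auto
  have "- K\<^sup>2 \<le> q x" for x
  proof -
    have "0 \<le> (norm x - K)\<^sup>2" by simp
    then show ?thesis
      using K[of x] by (simp add: q_def power2_norm_eq_inner[symmetric] power2_diff)
  qed
  then have bdd: "bdd_below (q ` S)"
    by (auto intro!: bdd_belowI2)
  define m where "m = Inf (q ` S)"
  have m_le: "m \<le> q x" if "x \<in> S" for x
    using cINF_lower[OF bdd that] by (simp add: m_def)
  have "\<exists>x\<in>S. q x < m + 1 / real (Suc n)" for n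
  proof (rule ccontr)
    assume "\<not> ?thesis"
    then have "m + 1 / real (Suc n) \<le> m"
      unfolding m_def
      by (intro cInf_greatest) (use subspace_0[OF assms(2)] in \<open>auto simp: m_def not_less\<close>)
    then show False by (simp add: field_simps)
  qed
  then obtain u where u: "\<And>n. u n \<in> S" "\<And>n. q (u n) < m + 1 / real (Suc n)"
    by metis
  \<comment> \<open>Parallelogram law; the terms in \<open>f\<close> cancel. Since midpoints stay in
    \<open>S\<close>, where \<open>q\<close> is at least \<open>m\<close>, a minimising sequence is
    Cauchy.\<close>
  have par: "(norm (x - y))\<^sup>2 = 2 * q x + 2 * q y - 4 * q ((1/2) *\<^sub>R (x + y))" for x y
    unfolding q_def power2_norm_eq_inner
    by (simp add: f.add f.scaleR inner_add_left inner_add_right inner_diff_left inner_diff_right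
        inner_commute[of y x] algebra_simps)
  have close: "(norm (u i - u j))\<^sup>2 \<le> 2 / real (Suc i) + 2 / real (Suc j)" for i j
  proof -
    have "(1/2) *\<^sub>R (u i + u j) \<in> S"
      using u(1) assms(2) by (simp add: subspace_add subspace_scale)
    from m_le[OF this] show ?thesis
      using u(2)[of i] u(2)[of j] unfolding par by linarith
  qed
  have "Cauchy u"
  proof (rule metric_CauchyI)
    fix e :: real assume "e > 0"
    then obtain N where N: "inverse (real (Suc N)) < e\<^sup>2 / 4"
      using reals_Archimedean[of "e\<^sup>2 / 4"] by auto
    have "dist (u i) (u j) < e" if "N \<le> i" "N \<le> j" for i j
    proof -
      have "1 / real (Suc i) \<le> inverse (real (Suc N))" "1 / real (Suc j) \<le> inverse (real (Suc N))"
        using that by (simp_all add: field_simps)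
      then have "(norm (u i - u j))\<^sup>2 < e\<^sup>2"
        using close[of i j] N by simp
      then show ?thesis
        using \<open>e > 0\<close> by (simp add: dist_norm power_less_imp_less_base)
    qed
    then show "\<exists>M. \<forall>i\<ge>M. \<forall>j\<ge>M. dist (u i) (u j) < e" by blast
  qed
  then obtain y where y: "u \<longlonglongrightarrow> y"
    using Cauchy_convergent_iff convergent_def by blast
  have yS: "y \<in> S"
    using closed_sequentially[OF assms(1)] u(1) y by blast
  have "(\<lambda>n. q (u n)) \<longlonglongrightarrow> q y"
    unfolding q_def by (intro tendsto_intros f.tendsto y)
  moreover have "(\<lambda>n. m + 1 / real (Suc n)) \<longlonglongrightarrow> m + 0"
    by (intro tendsto_add tendsto_const LIMSEQ_Suc[OF lim_1_over_n])
  ultimately have qy: "q y \<le> m"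
    by (intro LIMSEQ_le[of "\<lambda>n. q (u n)" "q y" "\<lambda>n. m + 1 / real (Suc n)"])
      (use u(2) in \<open>auto intro: less_imp_le\<close>)
  have "f x = inner x y" if "x \<in> S" for x
  proof (rule ccontr)
    assume neq: "f x \<noteq> inner x y"
    then have x: "inner x x > 0"
      by (metis f.zero inner_gt_zero_iff inner_zero_left)
    \<comment> \<open>Along the line through \<open>y\<close> in direction \<open>x\<close>,
      \<open>q\<close> is a parabola in the parameter with slope \<open>2 * d\<close> at
      \<open>y\<close>. Its vertex is at \<open>t\<close>, and for nonzero \<open>d\<close> the
      value there falls below the infimum.\<close>
    define d where "d = inner x y - f x"
    define t where "t = - d / inner x x"
    have "q (y + t *\<^sub>R x) = q y + 2 * t * d + t * t * inner x x"
      by (simp add: q_def d_def f.add f.scaleR inner_add_left inner_add_right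
          inner_commute[of y x] algebra_simps)
    also have "\<dots> = q y - d * d / inner x x"
      using x by (simp add: t_def field_simps)
    also have "\<dots> < q y"
    proof -
      have "d * d > 0"
        using neq by (metis d_def not_real_square_gt_zero right_minus_eq)
      then show ?thesis using x by simp
    qed
    finally show False
      using qy m_le[of "y + t *\<^sub>R x"] yS that assms(2) by (simp add: subspace_add subspace_scale)
  qed
  with yS show ?thesis
    using that by blast
qed

text \<open>Riesz represents the real part of the functional; complex linearity of \<open>A\<close>
  then takes care of the imaginary part. Uniqueness of the result justifies the definite description
  in \<open>cadjoint\<close>.\<close>

lemma cadjoint_cinner:
  fixes A :: "'h::chilbert_space \<Rightarrow> 'h"
  assumes "bounded_clinear A"
  shows "cinner (A x) y = cinner x (cadjoint A y)"
proof -
  have bl: "bounded_linear A" and scale: "\<And>c x. A (c *\<^sub>C x) = c *\<^sub>C A x"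
    using assms by (auto simp: bounded_clinear_def)
  have "\<exists>z. \<forall>x. inner (A x) y = inner x z" for y
  proof -
    have "bounded_linear (\<lambda>x. inner (A x) y)"
      by (rule bounded_linear_compose[OF bounded_linear_inner_left bl])
    then show ?thesis
      using riesz_on_closed_subspace[of UNIV "\<lambda>x. inner (A x) y"] by auto
  qed
  then obtain A' where A': "\<And>x y. inner (A x) y = inner x (A' y)"
    by metis
  have eq: "cinner (A x) y = cinner x (A' y)" for x y
  proof (rule complex_eqI)
    show "Re (cinner (A x) y) = Re (cinner x (A' y))"
      by (simp add: Re_cinner A')
    show "Im (cinner (A x) y) = Im (cinner x (A' y))"
      by (simp add: Im_cinner A'[symmetric] scale)
  qed
  have "cadjoint A = A'"
    unfolding cadjoint_def
  proof (rule the_equality)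
    show "\<forall>x y. cinner (A x) y = cinner x (A' y)" using eq by blast
    show "A'' = A'" if *: "\<forall>x y. cinner (A x) y = cinner x (A'' y)" for A''
    proof (rule ext, rule cinner_eqI)
      show "cinner x (A'' y) = cinner x (A' y)" for x y
        by (rule trans[OF *[rule_format, symmetric] eq])
    qed
  qed
  then show ?thesis by (simp only: eq)
qed

text \<open>If \<open>y\<close> is the orthogonal projection of \<open>v\<close> onto the closed
  span, then \<open>v - y\<close> is orthogonal to \<open>S\<close> and hence zero.\<close>

lemma closed_cspan_eq_UNIV:
  fixes S :: "'h::chilbert_space set"
  assumes "\<And>x. (\<And>s. s \<in> S \<Longrightarrow> cinner s x = 0) \<Longrightarrow> x = 0"
  shows "closed_cspan S = UNIV"
proof -
  let ?C = "closed_cspan S"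
  have C: "closed ?C" "subspace ?C"
    by (simp_all add: closed_cspan_def subspace_closure subspace_cspan_real)
  have "v \<in> ?C" for v
  proof -
    obtain y where y: "y \<in> ?C" "\<And>x. x \<in> ?C \<Longrightarrow> inner x v = inner x y"
      using riesz_on_closed_subspace[OF C bounded_linear_inner_left, of v] by blast
    have "cinner s (v - y) = 0" if "s \<in> S" for s
    proof -
      have "c *\<^sub>C s \<in> ?C" for c
        unfolding closed_cspan_def
        by (rule subsetD[OF closure_subset])
          (intro complex_vector.span_scale complex_vector.span_base that)
      then have *: "inner (c *\<^sub>C s) (v - y) = 0" for c
        using y(2) by (simp add: inner_diff_right)
      \<comment> \<open>Real orthogonality to both \<open>s\<close> and
        \<open>\<i> *\<^sub>C s\<close> amounts to complex orthogonality to
        \<open>s\<close>.\<close>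
      show ?thesis
        using *[of 1] *[of \<i>] by (simp add: complex_eq_iff Re_cinner Im_cinner)
    qed
    then have "v = y" using assms[of "v - y"] by simp
    then show ?thesis using y(1) by simp
  qed
  then show ?thesis by blast
qed

section \<open>Preimages of controlled norm\<close>

text \<open>A quantitative open mapping theorem. By Baire, the closure of the image of some ball has
  interior; this gives approximate preimages with half the error, and summing successive corrections
  gives exact ones.\<close>

lemma surj_bounded_preimage:
  fixes A :: "'a::banach \<Rightarrow> 'b::banach"
  assumes "bounded_linear A" "surj A"
  obtains C where "C > 0" "\<And>y. \<exists>x. A x = y \<and> norm x \<le> C * norm y"
proof -
  interpret A: bounded_linear A by fact
  define F where "F n = closure (A ` ball 0 (real (Suc n)))" for n
  have "\<exists>n. interior (F n) \<noteq> {}"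
  proof (rule ccontr)
    assume "\<not> ?thesis"
    then have "euclidean interior_of \<Union> (range F) = {}"
      by (intro Baire_category_alt disjI1 completely_metrizable_space_euclidean)
        (auto simp: F_def simp flip: euclidean_interior_of)
    moreover have "\<Union> (range F) = UNIV"
    proof -
      have "y \<in> \<Union> (range F)" for y
      proof -
        obtain x where x: "A x = y" using assms(2) by (metis surjD)
        obtain n where "norm x < real n" using reals_Archimedean2 by blast
        then have "x \<in> ball 0 (real (Suc n))" by simp
        then have "y \<in> F n"
          unfolding F_def using x by (intro subsetD[OF closure_subset]) blast
        then show ?thesis by blast
      qed
      then show ?thesis by blast
    qed
    ultimately show False by simp
  qed
  then obtain n y0 where "y0 \<in> interior (F n)"
    by blast
  then obtain e where e: "e > 0" "ball y0 e \<subseteq> F n"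
    unfolding mem_interior by blast
  define R where "R = real (Suc n)"
  define K where "K = 4 * R / e"
  have "K > 0" using e by (simp add: K_def R_def)
  \<comment> \<open>The tolerance is chosen so that two such errors, rescaled by the factor
    \<open>s\<close> below, add up to \<open>norm y / 2\<close>.\<close>
  have approx: "\<exists>a\<in>ball 0 R. dist (A a) v < e / 8" if "v \<in> ball y0 e" for v
  proof -
    have "v \<in> closure (A ` ball 0 R)"
      using that e(2) unfolding F_def R_def by blast
    then have "\<forall>\<delta>>0. \<exists>a\<in>ball 0 R. dist (A a) v < \<delta>"
      by (simp add: closure_approachable)
    moreover have "e / 8 > 0" using e(1) by simp
    ultimately show ?thesis by blast
  qed
  have "\<exists>x. norm x \<le> K * norm y \<and> norm (y - A x) \<le> norm y / 2" for y
  proof (cases "y = 0")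
    case True
    then show ?thesis by (intro exI[of _ 0]) (simp add: A.zero)
  next
    case False
    \<comment> \<open>\<open>u\<close> is \<open>y\<close> shrunk to length \<open>e / 2\<close>, so
      \<open>y0 + u\<close> and \<open>y0\<close> both lie in the ball. The difference of their
      approximate preimages, scaled back by \<open>s\<close>, nearly solves the equation for
      \<open>y\<close>.\<close>
    define s where "s = 2 * norm y / e"
    define u where "u = (1 / s) *\<^sub>R y"
    have s: "s > 0" using False e by (simp add: s_def)
    have "norm u = e / 2"
      using False e by (simp add: u_def s_def)
    then have "y0 + u \<in> ball y0 e" "y0 \<in> ball y0 e"
      using e by (simp_all add: dist_norm)
    from approx[OF this(1)] approx[OF this(2)]
    obtain a b where ab: "norm a < R" "norm b < R" "dist (A a) (y0 + u) < e / 8"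
        "dist (A b) y0 < e / 8"
      by auto
    let ?x = "s *\<^sub>R (a - b)"
    have "norm (a - b) \<le> 2 * R"
      using ab norm_triangle_ineq4[of a b] by linarith
    then have "norm ?x \<le> s * (2 * R)"
      using s by simp
    then have 1: "norm ?x \<le> K * norm y"
      by (simp add: s_def K_def field_simps)
    have "y - A ?x = s *\<^sub>R ((A b - y0) - (A a - (y0 + u)))"
      using s by (simp add: A.scaleR A.diff u_def algebra_simps)
    then have "norm (y - A ?x) = s * norm ((A b - y0) - (A a - (y0 + u)))"
      using s by simp
    also have "\<dots> \<le> s * (e / 8 + e / 8)"
      using ab s norm_triangle_ineq4[of "A b - y0" "A a - (y0 + u)"]
      by (intro mult_left_mono) (auto simp: dist_norm)
    also have "\<dots> = norm y / 2"
      using e by (simp add: s_def)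
    finally show ?thesis using 1 by blast
  qed
  then obtain g where g: "\<And>y. norm (g y) \<le> K * norm y" "\<And>y. norm (y - A (g y)) \<le> norm y / 2"
    by metis
  have "\<exists>x. A x = y \<and> norm x \<le> (2 * K) * norm y" for y
  proof -
    \<comment> \<open>\<open>r k\<close> is the error left after \<open>k\<close> corrections. It
      halves at each step, and the images of the corrections telescope to \<open>y\<close>.\<close>
    define r where "r k = ((\<lambda>v. v - A (g v)) ^^ k) y" for k
    have r: "r 0 = y" "\<And>k. r (Suc k) = r k - A (g (r k))"
      by (simp_all add: r_def)
    have r_le: "norm (r k) \<le> norm y * (1/2) ^ k" for k
    proof (induction k)
      case (Suc k)
      then show ?case using g(2)[of "r k"] r by simp
    qed (simp add: r)
    have g_le: "norm (g (r k)) \<le> K * norm y * (1/2) ^ k" for k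
      using order_trans[OF g(1) mult_left_mono[OF r_le]] \<open>K > 0\<close> by (simp add: mult.assoc)
    have geo: "(\<lambda>k. K * norm y * (1/2) ^ k) sums (K * norm y * 2)"
      using sums_mult[OF geometric_sums[of "1/2::real"], of "K * norm y"] by simp
    have nsum: "summable (\<lambda>k. norm (g (r k)))"
      by (rule summable_comparison_test'[OF sums_summable[OF geo]]) (simp add: g_le)
    define x where "x = (\<Sum>k. g (r k))"
    have x: "(\<lambda>k. g (r k)) sums x"
      unfolding x_def using summable_norm_cancel[OF nsum] by (rule summable_sums)
    have Ax: "(\<lambda>k. r k - r (Suc k)) sums A x"
      using A.sums[OF x] by (simp add: r(2))
    have "r \<longlonglongrightarrow> 0"
    proof (rule Lim_null_comparison)
      show "\<forall>\<^sub>F k in sequentially. norm (r k) \<le> norm y * (1/2) ^ k"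
        using r_le by simp
      show "(\<lambda>k. norm y * (1/2) ^ k) \<longlonglongrightarrow> 0"
        by (intro tendsto_mult_right_zero LIMSEQ_realpow_zero) auto
    qed
    then have "(\<lambda>k. r k - r (Suc k)) sums (r 0 - 0)"
      by (rule telescope_sums')
    from sums_unique2[OF Ax this] have "A x = y"
      by (simp add: r(1))
    moreover have "norm x \<le> K * norm y * 2"
      by (rule norm_sums_le[OF x geo g_le])
    then have "norm x \<le> (2 * K) * norm y"
      by simp
    ultimately show ?thesis by blast
  qed
  then show ?thesis using that[of "2 * K"] \<open>K > 0\<close> by simp
qed

section \<open>Eigenvectors near a point as power series\<close>

text \<open>Since \<open>A\<close> shifts the chain down and kills its first member, applying it to
  the series multiplies the sum by \<open>w\<close>. Radius \<open>1 / C\<close> would suffice for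
  convergence; half of it also keeps the sum away from zero.\<close>

lemma eigenvector_power_series:
  fixes A :: "'h::chilbert_space \<Rightarrow> 'h"
  assumes "bounded_clinear A" "A (x 0) = 0" "\<And>k. A (x (Suc k)) = x k" "x 0 \<noteq> 0"
    and "C > 0" "\<And>k. norm (x (Suc k)) \<le> C * norm (x k)" "cmod w < 1 / (2 * C)"
  obtains v where "(\<lambda>k. w ^ k *\<^sub>C x k) sums v" "A v = w *\<^sub>C v" "v \<noteq> 0"
proof -
  interpret A: bounded_linear A using assms(1) by (simp add: bounded_clinear_def)
  define q where "q = cmod w * C"
  have q: "0 \<le> q" "q < 1 / 2"
    using assms(5,7) by (simp_all add: q_def field_simps)
  have x_le: "norm (x k) \<le> C ^ k * norm (x 0)" for k
  proof (induction k)
    case (Suc k)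
    have "norm (x (Suc k)) \<le> C * norm (x k)" by (rule assms)
    also have "\<dots> \<le> C * (C ^ k * norm (x 0))"
      using Suc assms(5) by (intro mult_left_mono) auto
    finally show ?case by (simp add: mult.assoc)
  qed simp
  have le: "norm (w ^ k *\<^sub>C x k) \<le> q ^ k * norm (x 0)" for k
    using mult_left_mono[OF x_le[of k], of "cmod w ^ k"]
    by (simp add: norm_scaleC norm_power q_def power_mult_distrib mult.assoc)
  have geo: "(\<lambda>k. q ^ k * norm (x 0)) sums (1 / (1 - q) * norm (x 0))"
    using q by (intro sums_mult2 geometric_sums) auto
  define v where "v = (\<Sum>k. w ^ k *\<^sub>C x k)"
  have "summable (\<lambda>k. norm (w ^ k *\<^sub>C x k))"
    by (rule summable_comparison_test'[OF sums_summable[OF geo]]) (simp add: le)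
  then have v: "(\<lambda>k. w ^ k *\<^sub>C x k) sums v"
    unfolding v_def by (rule summable_sums[OF summable_norm_cancel])
  have scale: "A (c *\<^sub>C y) = c *\<^sub>C A y" for c y
    using assms(1) by (simp add: bounded_clinear_def)
  have "(\<lambda>k. w ^ k *\<^sub>C A (x k)) sums A v"
    using A.sums[OF v] by (simp add: scale)
  then have "(\<lambda>k. w ^ Suc k *\<^sub>C x k) sums A v"
    using sums_Suc_iff[of "\<lambda>k. w ^ k *\<^sub>C A (x k)" "A v"] assms(2,3) by simp
  moreover have "(\<lambda>k. w ^ Suc k *\<^sub>C x k) sums (w *\<^sub>C v)"
    using bounded_linear.sums[OF bounded_linear_scaleC_right v, of w] by (simp add: scaleC_scaleC)
  ultimately have Av: "A v = w *\<^sub>C v"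
    by (rule sums_unique2)
  \<comment> \<open>If the sum vanished, the tail after the first term would equal
    \<open>- x 0\<close>, but its norm is at most \<open>q / (1 - q)\<close> times that of
    \<open>x 0\<close>, and \<open>q < 1 / 2\<close>.\<close>
  have "v \<noteq> 0"
  proof
    assume "v = 0"
    then have "(\<lambda>k. w ^ Suc k *\<^sub>C x (Suc k)) sums (- x 0)"
      using v sums_Suc_iff[of "\<lambda>k. w ^ k *\<^sub>C x k" "- x 0"] by simp
    moreover have geo': "(\<lambda>k. q ^ Suc k * norm (x 0)) sums (q / (1 - q) * norm (x 0))"
      using sums_mult[OF geo, of q] by (simp add: mult.assoc)
    ultimately have "norm (- x 0) \<le> q / (1 - q) * norm (x 0)"
      by (rule norm_sums_le) (rule le)
    moreover have "q / (1 - q) < 1" using q by (simp add: field_simps)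
    then have "q / (1 - q) * norm (x 0) < 1 * norm (x 0)"
      using assms(4) by (intro mult_strict_right_mono) auto
    ultimately show False by simp
  qed
  with v Av that show ?thesis by blast
qed

lemma bounded_clinear_minus_scalar:
  assumes "bounded_clinear T"
  shows "bounded_clinear (minus_scalar T z)"
  using assms unfolding bounded_clinear_def minus_scalar_def
  by (auto intro!: bounded_linear_sub bounded_linear_scaleC_right
      simp: complex_vector.scale_right_diff_distrib scaleC_scaleC mult.commute)

lemma kern_eq_line:
  assumes "bounded_clinear A" "complex_vector.dim (kern A) = 1" "u \<in> kern A" "u \<noteq> 0"
  shows "kern A = range (\<lambda>c. c *\<^sub>C u)"
proof -
  obtain b where b: "kern A \<subseteq> complex_vector.span b" "card b = 1"
    using assms(2) by (metis complex_vector.basis_exists)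
  then obtain v where "kern A \<subseteq> range (\<lambda>c. c *\<^sub>C v)"
    by (metis card_1_singletonE complex_vector.span_singleton)
  with assms(3) obtain c where v: "\<And>x. x \<in> kern A \<Longrightarrow> \<exists>d. x = d *\<^sub>C v" and c: "u = c *\<^sub>C v"
    by blast
  have "c \<noteq> 0" using assms(4) c by auto
  have "x \<in> range (\<lambda>c. c *\<^sub>C u)" if x: "x \<in> kern A" for x
  proof -
    obtain d where "x = d *\<^sub>C v" using v x by blast
    then have "x = (d / c) *\<^sub>C u" using \<open>c \<noteq> 0\<close> by (simp add: c scaleC_scaleC)
    then show ?thesis by blast
  qed
  moreover have "c *\<^sub>C u \<in> kern A" for c
    using assms(1,3) by (simp add: kern_def bounded_clinear_def)
  ultimately show ?thesis by blast
qed

lemma kern_nontrivial: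
  assumes "complex_vector.dim (kern A) = 1"
  obtains u where "u \<in> kern A" "u \<noteq> 0"
proof (rule ccontr)
  assume *: "\<not> thesis"
  have "kern A \<subseteq> {0}"
    using * that by blast
  then have "kern A \<subseteq> complex_vector.span {}"
    by simp
  then have "complex_vector.dim (kern A) \<le> card ({} :: 'a set)"
    by (intro complex_vector.dim_le_card) simp_all
  with assms show False by simp
qed

text \<open>Near \<open>a\<close> the eigenvector series spans the whole one-dimensional kernel. As
  \<open>cinner\<close> is linear in its first argument, pairing the series with \<open>y\<close>
  gives a power series in \<open>z - a\<close>, whose zeros detect orthogonality to the
  kernel.\<close>

lemma kern_orthogonal_local:
  fixes T :: "'h::chilbert_space \<Rightarrow> 'h"
  assumes T: "bounded_clinear T"
    and x: "minus_scalar T a (x 0) = 0" "\<And>k. minus_scalar T a (x (Suc k)) = x k" "x 0 \<noteq> 0"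
    and C: "C > 0" "\<And>k. norm (x (Suc k)) \<le> C * norm (x k)"
    and \<Omega>: "open \<Omega>" "a \<in> \<Omega>"
    and dim: "\<And>z. z \<in> \<Omega> \<Longrightarrow> complex_vector.dim (kern (minus_scalar T z)) = 1"
  obtains r F where "r > 0" "ball a r \<subseteq> \<Omega>"
    "\<And>z. z \<in> ball a r \<Longrightarrow> (\<lambda>k. cinner (x k) y * (z - a) ^ k) sums F z"
    "\<And>z. z \<in> ball a r \<Longrightarrow> F z = 0 \<longleftrightarrow> (\<forall>v\<in>kern (minus_scalar T z). cinner v y = 0)"
proof -
  obtain r0 where r0: "r0 > 0" "ball a r0 \<subseteq> \<Omega>"
    using \<Omega> open_contains_ball by blast
  define r where "r = min r0 (1 / (2 * C))"
  have r: "r > 0" "ball a r \<subseteq> \<Omega>"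
    using r0 C(1) by (auto simp: r_def)
  have "\<exists>v. (\<lambda>k. (z - a) ^ k *\<^sub>C x k) sums v \<and> v \<in> kern (minus_scalar T z) \<and> v \<noteq> 0"
    if z: "z \<in> ball a r" for z
  proof -
    have small: "cmod (z - a) < 1 / (2 * C)"
      using z by (simp add: r_def dist_norm norm_minus_commute)
    obtain v where v: "(\<lambda>k. (z - a) ^ k *\<^sub>C x k) sums v" "minus_scalar T a v = (z - a) *\<^sub>C v"
        "v \<noteq> 0"
      using eigenvector_power_series[OF bounded_clinear_minus_scalar[OF T] x C small] by blast
    \<comment> \<open>The eigenvalue equation for \<open>T - a\<close> at \<open>z - a\<close> is
      the one for \<open>T\<close> at \<open>z\<close>.\<close>
    have "v \<in> kern (minus_scalar T z)"
      using v(2) by (simp add: kern_def minus_scalar_def complex_vector.scale_left_diff_distrib)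
    with v show ?thesis by blast
  qed
  then obtain g where g: "\<And>z. z \<in> ball a r \<Longrightarrow> (\<lambda>k. (z - a) ^ k *\<^sub>C x k) sums g z"
      "\<And>z. z \<in> ball a r \<Longrightarrow> g z \<in> kern (minus_scalar T z)"
      "\<And>z. z \<in> ball a r \<Longrightarrow> g z \<noteq> 0"
    by metis
  show ?thesis
  proof (rule that[OF r, of "\<lambda>z. cinner (g z) y"])
    fix z assume z: "z \<in> ball a r"
    show "(\<lambda>k. cinner (x k) y * (z - a) ^ k) sums cinner (g z) y"
      using bounded_linear.sums[OF bounded_linear_cinner_left g(1)[OF z], of y]
      by (simp add: cinner_scaleC_left mult.commute)
    have "kern (minus_scalar T z) = range (\<lambda>c. c *\<^sub>C g z)"
      using z r(2) by (intro kern_eq_line bounded_clinear_minus_scalar T dim g) auto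
    then show "cinner (g z) y = 0 \<longleftrightarrow> (\<forall>v\<in>kern (minus_scalar T z). cinner v y = 0)"
      using g(2)[OF z] by (auto simp: cinner_scaleC_left)
  qed
qed

section \<open>Continuation of orthogonality through \<Omega>\<close>

text \<open>Supplies the expansion chain at arbitrary points of \<Omega>, where no right inverse is
  given. Iterating a choice of preimages with bounded norm is enough; the choice need not be
  linear.\<close>

lemma kern_chain_exists:
  fixes A :: "'h::chilbert_space \<Rightarrow> 'h"
  assumes "bounded_clinear A" "surj A" "complex_vector.dim (kern A) = 1"
  obtains x C where "A (x 0) = 0" "\<And>k. A (x (Suc k)) = x k" "x 0 \<noteq> 0"
    "C > 0" "\<And>k. norm (x (Suc k)) \<le> C * norm (x k)"
proof -
  have "bounded_linear A" using assms(1) by (simp add: bounded_clinear_def)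
  then obtain C where C: "C > 0" "\<And>y. \<exists>x. A x = y \<and> norm x \<le> C * norm y"
    using surj_bounded_preimage assms(2) by blast
  then obtain g where g: "\<And>y. A (g y) = y" "\<And>y. norm (g y) \<le> C * norm y"
    by metis
  obtain u where u: "u \<in> kern A" "u \<noteq> 0"
    using kern_nontrivial[OF assms(3)] by blast
  show ?thesis
    by (rule that[of "\<lambda>k. (g ^^ k) u" C]) (use u C g in \<open>simp_all add: kern_def\<close>)
qed

text \<open>
  Orthogonality to the eigenvectors spreads through \<open>\<Omega>\<close> by the identity theorem, applied to
  the scalar products of \<open>y\<close> with local holomorphic sections of the eigenvectors.
\<close>

lemma cowen_douglas_chain_total:
  fixes T :: "'h::chilbert_space \<Rightarrow> 'h"
  assumes T: "T \<in> cowen_douglas_1 \<Omega>"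
    and \<Omega>: "open \<Omega>" "connected \<Omega>" "z0 \<in> \<Omega>"
    and x: "minus_scalar T z0 (x 0) = 0" "\<And>k. minus_scalar T z0 (x (Suc k)) = x k" "x 0 \<noteq> 0"
    and C: "C > 0" "\<And>k. norm (x (Suc k)) \<le> C * norm (x k)"
    and y: "\<And>k. cinner (x k) y = 0"
  shows "y = 0"
proof -
  have bT: "bounded_clinear T"
    and surj: "\<And>z. z \<in> \<Omega> \<Longrightarrow> surj (minus_scalar T z)"
    and dim: "\<And>z. z \<in> \<Omega> \<Longrightarrow> complex_vector.dim (kern (minus_scalar T z)) = 1"
    and total: "closed_cspan (\<Union>z\<in>\<Omega>. kern (minus_scalar T z)) = UNIV"
    using T by (auto simp: cowen_douglas_1_def)
  define perp where "perp z \<longleftrightarrow> (\<forall>v\<in>kern (minus_scalar T z). cinner v y = 0)" for z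
  \<comment> \<open>Orthogonality at a single point does not propagate; the identity theorem needs
    it on a nonempty open set, so \<open>P\<close> asks for a neighbourhood.\<close>
  define P where "P z \<longleftrightarrow> (\<exists>U. open U \<and> z \<in> U \<and> (\<forall>w\<in>U. perp w))" for z
  have base: "P z0"
  proof -
    obtain r F where r: "r > 0" "ball z0 r \<subseteq> \<Omega>"
      and F: "\<And>z. z \<in> ball z0 r \<Longrightarrow> (\<lambda>k. cinner (x k) y * (z - z0) ^ k) sums F z"
        "\<And>z. z \<in> ball z0 r \<Longrightarrow> F z = 0 \<longleftrightarrow> perp z"
      by (rule kern_orthogonal_local[OF bT x C \<Omega>(1,3), where y = y, folded perp_def])
        (erule dim, rule that)
    have "perp z" if z: "z \<in> ball z0 r" for z
    proof -
      \<comment> \<open>At the centre \<open>z0\<close> the coefficients of the series are exactly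
        the products assumed to vanish.\<close>
      have "(\<lambda>k. 0) sums F z"
        using F(1)[OF z] by (simp add: y)
      then have "F z = 0"
        using sums_unique2 sums_zero by metis
      then show ?thesis using F(2)[OF z] by simp
    qed
    then show ?thesis
      unfolding P_def using r centre_in_ball open_ball by blast
  qed
  \<comment> \<open>The form required by induction over a connected set: around each
    \<open>a\<close> the property passes between any two points of a small ball, using a chain
    centred at \<open>a\<close>.\<close>
  have spread: "\<exists>U. openin (top_of_set \<Omega>) U \<and> a \<in> U \<and> (\<forall>z\<in>U. \<forall>w\<in>U. P z \<longrightarrow> P w)"
    if a: "a \<in> \<Omega>" for a
  proof -
    obtain s D where s: "minus_scalar T a (s 0) = 0" "\<And>k. minus_scalar T a (s (Suc k)) = s k"
        "s 0 \<noteq> 0" and D: "D > 0" "\<And>k. norm (s (Suc k)) \<le> D * norm (s k)"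
      by (rule kern_chain_exists[OF bounded_clinear_minus_scalar[OF bT] surj[OF a] dim[OF a]])
        (rule that)
    obtain r F where r: "r > 0" "ball a r \<subseteq> \<Omega>"
      and F: "\<And>z. z \<in> ball a r \<Longrightarrow> (\<lambda>k. cinner (s k) y * (z - a) ^ k) sums F z"
        "\<And>z. z \<in> ball a r \<Longrightarrow> F z = 0 \<longleftrightarrow> perp z"
      by (rule kern_orthogonal_local[OF bT s D \<Omega>(1) a, where y = y, folded perp_def])
        (erule dim, rule that)
    have holF: "F holomorphic_on ball a r"
      using F(1) by (rule power_series_holomorphic)
    have "P w" if z: "z \<in> ball a r" "P z" and w: "w \<in> ball a r" for z w
    proof -
      obtain U where U: "open U" "z \<in> U" "\<And>u. u \<in> U \<Longrightarrow> perp u"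
        using z(2) unfolding P_def by blast
      have F0: "F v = 0" if v: "v \<in> ball a r" for v
      proof (rule analytic_continuation_open[of "U \<inter> ball a r" "ball a r" F "\<lambda>_. 0"])
        show "U \<inter> ball a r \<noteq> {}" using z U by blast
        show "F u = 0" if "u \<in> U \<inter> ball a r" for u
          using U(3)[of u] F(2)[of u] that by simp
      qed (use U(1) v holF in auto)
      have "\<forall>v\<in>ball a r. perp v"
        using F(2) F0 by blast
      then show ?thesis
        unfolding P_def using w open_ball by blast
    qed
    moreover have "openin (top_of_set \<Omega>) (ball a r)"
      using r(2) by (simp add: open_subset)
    ultimately show ?thesis
      using r(1) centre_in_ball by blast
  qed
  have "perp z" if "z \<in> \<Omega>" for z
  proof -
    have "P z"
      using \<Omega>(2,3) that base spread by (rule connected_induction_simple)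
    then show ?thesis unfolding P_def by blast
  qed
  then have "cinner y y = 0"
    by (intro cinner_closed_cspan_zero[of y "\<Union>z\<in>\<Omega>. kern (minus_scalar T z)" y])
      (auto simp: total perp_def)
  then show ?thesis by simp
qed

section \<open>From a backward shift to invariance\<close>

lemma cadjoint_scaleC:
  fixes A :: "'h::chilbert_space \<Rightarrow> 'h"
  assumes "bounded_clinear A"
  shows "cadjoint A (c *\<^sub>C y) = c *\<^sub>C cadjoint A y"
  by (rule cinner_eqI) (simp add: cinner_scaleC_right flip: cadjoint_cinner[OF assms])

lemma funpow_scaleC:
  assumes "bounded_clinear B"
  shows "(B ^^ k) (c *\<^sub>C x) = c *\<^sub>C (B ^^ k) x"
  using assms by (induction k) (simp_all add: bounded_clinear_def)

lemma orthonormal_basis_eqI: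
  assumes "orthonormal_basis e" "\<And>j. cinner (e j) x = cinner (e j) y"
  shows "x = y"
proof -
  have "cinner (x - y) (x - y) = 0"
  proof (rule cinner_closed_cspan_zero)
    show "x - y \<in> closed_cspan (range e)"
      using assms(1) by (simp add: orthonormal_basis_def)
    show "cinner s (x - y) = 0" if "s \<in> range e" for s
      using that assms(2) by (auto simp: cinner_diff_right)
  qed
  then show ?thesis by simp
qed

lemma backward_shift_imp_invariant:
  fixes A B :: "'h::chilbert_space \<Rightarrow> 'h"
  assumes A: "bounded_clinear A" "complex_vector.dim (kern A) = 1"
    and B: "canonical_right_inverse A B"
    and e: "orthonormal_basis e" "backward_weighted_shift e w A"
  shows "invariant_for ((B ^^ k) ` kern A) (cadjoint B \<circ> B)"
proof -
  have bB: "bounded_clinear B" and AB: "\<And>x. A (B x) = x"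
    and ranB: "range B = orthogonal_complement (kern A)"
    using B by (auto simp: canonical_right_inverse_def fun_eq_iff)
  have scaleB: "B (c *\<^sub>C x) = c *\<^sub>C B x" for c x
    using bB by (simp add: bounded_clinear_def)
  have ortho: "cinner (e i) (e j) = (if i = j then 1 else 0)" for i j
    using e(1) by (simp add: orthonormal_basis_def)
  have e_nz: "e k \<noteq> 0" for k
    using ortho[of k k] by auto
  have Ae: "A (e 0) = 0" "A (e (Suc k)) = w (Suc k) *\<^sub>C e k" for k
    using e(2) by (auto simp: backward_weighted_shift_def)
  have kern: "kern A = range (\<lambda>c. c *\<^sub>C e 0)"
    using Ae(1) e_nz by (intro kern_eq_line A) (simp_all add: kern_def)
  \<comment> \<open>\<open>e (Suc k)\<close> is orthogonal to the kernel line of \<open>e 0\<close>,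
    so it lies in the range of \<open>B\<close> and is recovered by \<open>B\<close> from its image
    under \<open>A\<close>. In particular the weights from index 1 on are nonzero.\<close>
  have Be': "w (Suc k) *\<^sub>C B (e k) = e (Suc k)" for k
  proof -
    have "e (Suc k) \<in> range B"
      unfolding ranB kern orthogonal_complement_def by (auto simp: cinner_scaleC_right ortho)
    then obtain x where x: "e (Suc k) = B x" by blast
    then have "x = w (Suc k) *\<^sub>C e k" using AB[of x] Ae(2)[of k] by simp
    with x show ?thesis by (simp add: scaleB)
  qed
  have "\<exists>c. B (e k) = c *\<^sub>C e (Suc k)" for k
  proof -
    have "w (Suc k) \<noteq> 0" using Be'[of k] e_nz[of "Suc k"] by auto
    then have "B (e k) = inverse (w (Suc k)) *\<^sub>C e (Suc k)"
      by (simp add: Be'[of k, symmetric] scaleC_scaleC)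
    then show ?thesis by blast
  qed
  then obtain c where Be: "\<And>k. B (e k) = c k *\<^sub>C e (Suc k)"
    by metis
  have eig: "cadjoint B (B (e k)) = (cnj (c k) * c k) *\<^sub>C e k" for k
  proof (rule orthonormal_basis_eqI[OF e(1)])
    fix j
    have "cinner (e j) (cadjoint B (B (e k))) = cinner (B (e j)) (B (e k))"
      by (rule cadjoint_cinner[OF bB, symmetric])
    also have "\<dots> = cnj (c k) * (c j * cinner (e (Suc j)) (e (Suc k)))"
      by (simp add: Be cinner_scaleC_left cinner_scaleC_right)
    also have "\<dots> = cinner (e j) ((cnj (c k) * c k) *\<^sub>C e k)"
      by (simp add: cinner_scaleC_right ortho)
    finally show "cinner (e j) (cadjoint B (B (e k))) = cinner (e j) ((cnj (c k) * c k) *\<^sub>C e k)" .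
  qed
  have pow: "\<exists>d. (B ^^ k) (e 0) = d *\<^sub>C e k" for k
  proof (induction k)
    case 0
    show ?case by (intro exI[of _ 1]) simp
  next
    case (Suc k)
    then obtain d where "(B ^^ k) (e 0) = d *\<^sub>C e k" by blast
    then have "(B ^^ Suc k) (e 0) = (d * c k) *\<^sub>C e (Suc k)"
      by (simp add: scaleB Be scaleC_scaleC)
    then show ?case by blast
  qed
  show ?thesis
    unfolding invariant_for_def
  proof (intro image_subsetI)
    fix v assume "v \<in> (B ^^ k) ` kern A"
    then obtain a where a: "a \<in> kern A" "v = (B ^^ k) a" by blast
    obtain s where s: "a = s *\<^sub>C e 0"
      using a(1) kern by blast
    obtain t where "(B ^^ k) (e 0) = t *\<^sub>C e k"
      using pow by blast
    then have d: "v = (s * t) *\<^sub>C e k"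
      by (simp add: a(2) s funpow_scaleC[OF bB] scaleC_scaleC)
    have "(cadjoint B \<circ> B) v = (cnj (c k) * c k) *\<^sub>C v"
      by (simp add: d scaleB cadjoint_scaleC[OF bB] eig scaleC_scaleC mult.commute)
    \<comment> \<open>The eigenvalue moves inside the power of \<open>B\<close>, where the kernel
      absorbs it.\<close>
    also have "\<dots> = (B ^^ k) ((cnj (c k) * c k) *\<^sub>C a)"
      by (simp add: a(2) funpow_scaleC[OF bB])
    finally show "(cadjoint B \<circ> B) v \<in> (B ^^ k) ` kern A"
      using kern s scaleC_scaleC by auto
  qed
qed

section \<open>From invariance to a backward shift\<close>

text \<open>Totality of the vectors \<open>(B ^^ k) u\<close> enters as a hypothesis, which
  separates the analytic input from the Hilbert space algebra carried out here.\<close>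

lemma invariant_imp_backward_shift:
  fixes A B :: "'h::chilbert_space \<Rightarrow> 'h"
  assumes A: "bounded_clinear A" "kern A = range (\<lambda>c. c *\<^sub>C u)" "u \<noteq> 0"
    and B: "canonical_right_inverse A B"
    and total: "\<And>y. (\<And>k. cinner ((B ^^ k) u) y = 0) \<Longrightarrow> y = 0"
    and inv: "\<And>k. invariant_for ((B ^^ k) ` kern A) (cadjoint B \<circ> B)"
  shows "\<exists>e w. orthonormal_basis e \<and> backward_weighted_shift e w A"
proof -
  have bB: "bounded_clinear B" and AB: "\<And>x. A (B x) = x"
    and ranB: "range B = orthogonal_complement (kern A)"
    using B by (auto simp: canonical_right_inverse_def fun_eq_iff)
  have scaleA: "A (c *\<^sub>C x) = c *\<^sub>C A x" for c x
    using A(1) by (simp add: bounded_clinear_def)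
  have A0: "A 0 = 0"
    using scaleA[of 0 0] by simp
  define p where "p k = (B ^^ k) u" for k
  have p_Suc: "p (Suc k) = B (p k)" for k by (simp add: p_def)
  have u: "u \<in> kern A" using A(2) complex_vector.scale_one by (metis rangeI)
  \<comment> \<open>An invariant line is spanned by an eigenvector.\<close>
  have eig: "\<exists>c. cadjoint B (B (p k)) = c *\<^sub>C p k" for k
  proof -
    have "p k \<in> (B ^^ k) ` kern A" using u by (simp add: p_def)
    then have "(cadjoint B \<circ> B) (p k) \<in> (B ^^ k) ` kern A"
      using inv[of k] unfolding invariant_for_def by blast
    then show ?thesis by (auto simp: A(2) p_def funpow_scaleC[OF bB])
  qed
  \<comment> \<open>Induction on the smaller index: moving one \<open>B\<close> across as an adjoint
    and using \<open>eig\<close> lowers both indices by one. At index 0, \<open>u\<close> lies in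
    the kernel and \<open>p k\<close> in its orthogonal complement.\<close>
  have orth_less: "cinner (p j) (p k) = 0" if "j < k" for j k
    using that
  proof (induction j arbitrary: k)
    case 0
    then obtain k' where "k = Suc k'" using gr0_conv_Suc by blast
    then have "p k \<in> orthogonal_complement (kern A)"
      using ranB p_Suc by auto
    then have "cinner (p k) (p 0) = 0"
      using u by (simp add: orthogonal_complement_def p_def)
    then show ?case by (simp add: cinner_eq_zero_commute)
  next
    case (Suc j)
    then obtain k' where k': "k = Suc k'" "j < k'" by (metis Suc_lessE)
    obtain c where "cadjoint B (B (p k')) = c *\<^sub>C p k'" using eig by blast
    then show ?case
      using Suc.IH[OF k'(2)]
      by (simp add: k'(1) p_Suc cadjoint_cinner[OF bB] cinner_scaleC_right)
  qed
  then have orth: "cinner (p j) (p k) = 0" if "j \<noteq> k" for j k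
    using that by (metis cinner_eq_zero_commute linorder_neqE_nat)
  have p_nz: "p k \<noteq> 0" for k
  proof (induction k)
    case (Suc k)
    then show ?case using AB A0 by (metis p_Suc)
  qed (simp add: p_def A(3))
  have Ap: "A (p 0) = 0" "A (p (Suc k)) = p k" for k
    using u AB by (simp_all add: p_def kern_def)
  \<comment> \<open>\<open>A\<close> takes \<open>p k\<close> to \<open>p (k - 1)\<close> for
    positive \<open>k\<close>, so normalising both vectors leaves the ratio of their norms as
    weight.\<close>
  define e where "e k = complex_of_real (1 / norm (p k)) *\<^sub>C p k" for k
  define w where "w k = complex_of_real (norm (p (k - 1)) / norm (p k))" for k
  have "cinner (e i) (e j) = (if i = j then 1 else 0)" for i j
    using orth[of i j] p_nz[of i]
    by (auto simp add: e_def cinner_scaleC_left cinner_scaleC_right cinner_self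
        power2_norm_eq_inner[symmetric] power2_eq_square)
  moreover have "closed_cspan (range e) = UNIV"
  proof (rule closed_cspan_eq_UNIV)
    fix y assume y: "\<And>s. s \<in> range e \<Longrightarrow> cinner s y = 0"
    have "cinner ((B ^^ k) u) y = 0" for k
      using y[of "e k"] p_nz[of k] by (simp add: e_def cinner_scaleC_left flip: p_def)
    then show "y = 0" by (rule total)
  qed
  ultimately have "orthonormal_basis e"
    by (simp add: orthonormal_basis_def)
  moreover have "backward_weighted_shift e w A"
    unfolding backward_weighted_shift_def
  proof (intro conjI allI impI)
    show "A (e 0) = 0" by (simp add: e_def scaleA Ap)
    fix k :: nat assume "1 \<le> k"
    then obtain j where "k = Suc j" using Suc_le_D by auto
    then show "A (e k) = w k *\<^sub>C e (k - 1)"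
      using p_nz[of j] by (simp add: e_def w_def scaleA Ap scaleC_scaleC)
  qed
  ultimately show ?thesis by blast
qed

theorem theorem4p3:
  fixes \<Omega> :: "complex set" and z\<^sub>0 :: complex
    and T B :: "'h::chilbert_space \<Rightarrow> 'h"
  assumes "separable_space (euclidean :: 'h topology)"
    and "infinite_dimensional TYPE('h)"
    and "open \<Omega>" and "connected \<Omega>"
    and "T \<in> cowen_douglas_1 \<Omega>"
    and "z\<^sub>0 \<in> \<Omega>"
    and "canonical_right_inverse (minus_scalar T z\<^sub>0) B"
  shows "(\<exists>e w. orthonormal_basis e \<and> backward_weighted_shift e w (minus_scalar T z\<^sub>0)) \<longleftrightarrow>
    (\<forall>k. invariant_for ((B ^^ k) ` kern (minus_scalar T z\<^sub>0)) (cadjoint B \<circ> B))"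
proof -
  let ?A = "minus_scalar T z\<^sub>0"
  have A: "bounded_clinear ?A" "complex_vector.dim (kern ?A) = 1"
    using assms(5,6) by (auto simp: cowen_douglas_1_def intro: bounded_clinear_minus_scalar)
  obtain u where u: "u \<in> kern ?A" "u \<noteq> 0"
    using kern_nontrivial[OF A(2)] by blast
  have B: "bounded_linear B" "\<And>x. ?A (B x) = x"
    using assms(7) by (auto simp: canonical_right_inverse_def bounded_clinear_def fun_eq_iff)
  obtain C where C: "C > 0" "\<And>x. norm (B x) \<le> C * norm x"
    using bounded_linear.pos_bounded[OF B(1)] by (metis mult.commute)
  \<comment> \<open>At \<open>z\<^sub>0\<close> the powers of \<open>B\<close> on \<open>u\<close>
    form the chain, with growth constant taken from the boundedness of \<open>B\<close>.\<close>
  have total: "y = 0" if "\<And>k. cinner ((B ^^ k) u) y = 0" for y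
    by (rule cowen_douglas_chain_total[OF assms(5,3,4,6), where x = "\<lambda>k. (B ^^ k) u" and C = C])
      (use u B(2) C that in \<open>simp_all add: kern_def\<close>)
  show ?thesis
  proof
    assume "\<exists>e w. orthonormal_basis e \<and> backward_weighted_shift e w ?A"
    then show "\<forall>k. invariant_for ((B ^^ k) ` kern ?A) (cadjoint B \<circ> B)"
      using backward_shift_imp_invariant[OF A assms(7)] by blast
  next
    assume "\<forall>k. invariant_for ((B ^^ k) ` kern ?A) (cadjoint B \<circ> B)"
    then have inv: "\<And>k. invariant_for ((B ^^ k) ` kern ?A) (cadjoint B \<circ> B)"
      by blast
    show "\<exists>e w. orthonormal_basis e \<and> backward_weighted_shift e w ?A"
      using invariant_imp_backward_shift[OF A(1) kern_eq_line[OF A u] u(2) assms(7) total inv] .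
  qed
qed

end
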